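(* Let $\mathcal{L}$ be a finite relational language. If $U$ is an ultraextensive $\mathcal{L}$-structure, then every countable substructure $C\subseteq U$ can be extended to a countable ultraextensive substructure $D\subseteq U$ (that is, there is a countable substructure $D$ with $C\subseteq D\subseteq U$ such that $D$ is ultraextensive).
   Context: Basic notions. Substructures are induced substructures; $D$ is an extension of $C$ if $C$ is a substructure of $D$. HL-extensions. A partial isomorphism of an $\mathcal{L}$-structure $C$ is an isomorphism between two finite substructures of $C$. $\mathcal{P}_C$ denotes the set of partial isomorphisms $p$ of $C$ that are not restrictions of the identity map $1_C$. If $C_1\subseteq C_2$ then $\mathcal{P}_{C_1}\subseteq\mathcal{P}_{C_2}$. An HL-extension of $C$ is a pair $(D,\phi)$ where $D$ is an extension of $C$ and $\phi:\mathcal{P}_C\to\mathrm{Aut}(D)$ is such that $\phi(p)$ extends $p$ for all $p\in\mathcal{P}_C$; it is assumed throughout that $\phi(p^{-1})=\phi(p)^{-1}$. It is finite if $D$ is finite. It is minimal if for every $b\in D\setminus C$ there are $p_1,\dots,p_n\in\mathcal{P}_C$ and $a\in C$ with $b=\phi(p_1)\cdots\phi(p_n)(a)$. Coherence. Let $C_1\subseteq C_2$ and let $(D_i,\phi_i)$ be an HL-extension of $C_i$, $i=1,2$. They are coherent if (i) $D_2$ extends $D_1$; (ii) $\phi_2(p)$ extends $\phi_1(p)$ for all $p\in\mathcal{P}_{C_1}$; (iii) with $K_i=\langle\phi_i(\mathcal{P}_{C_i})\rangle\le\mathrm{Aut}(D_i)$, the map $\phi_1(p)\mapsto\phi_2(p)$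 ($p\in\mathcal{P}_{C_1}$) has a unique extension to an injective group homomorphism $K_1\to K_2$. Ultraextensive. An $\mathcal{L}$-structure $U$ is ultraextensive if (i) $U$ is ultrahomogeneous, i.e. there is $\phi$ such that $(U,\phi)$ is an HL-extension of $U$; (ii) every finite substructure $C\subseteq U$ has a finite HL-extension $(D,\phi)$ with $D\subseteq U$; (iii) if $C_1\subseteq C_2\subseteq U$ are finite and $(D_1,\phi_1)$ is a finite minimal HL-extension of $C_1$ with $D_1\subseteq U$, then there is a finite minimal HL-extension $(D_2,\phi_2)$ of $C_2$ with $D_2\subseteq U$ such that $(D_1,\phi_1)$ and $(D_2,\phi_2)$ are coherent. *)

theory Defs
  imports
    "HOL-Algebra.Bij"
    "HOL-Algebra.Generated_Groups"
    "HOL-Library.Countable_Set"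
begin

record 'r language =
  symbols :: "'r set"
  arity :: "'r \<Rightarrow> nat"

record ('a, 'r) struct = "'a partial_object" +
  interp :: "'r \<Rightarrow> 'a list set"

text \<open>The interpretation of an \<open>r\<close> that is not a symbol of the language is irrelevant.
  The empty structure is allowed.\<close>

definition is_struct :: "'r language \<Rightarrow> ('a, 'r) struct \<Rightarrow> bool" where
  "is_struct L C \<longleftrightarrow>
     (\<forall>r \<in> symbols L. interp C r \<subseteq> {xs \<in> lists (carrier C). length xs = arity L r})"

definition substructure :: "'r language \<Rightarrow> ('a, 'r) struct \<Rightarrow> ('a, 'r) struct \<Rightarrow> bool" where
  "substructure L C D \<longleftrightarrow>
     is_struct L C \<and> is_struct L D \<and> carrier C \<subseteq> carrier D \<and>
     (\<forall>r \<in> symbols L. interp C r = interp D r \<inter> lists (carrier C))"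

definition struct_iso ::
    "'r language \<Rightarrow> ('a, 'r) struct \<Rightarrow> ('b, 'r) struct \<Rightarrow> ('a \<Rightarrow> 'b) set" where
  "struct_iso L A B =
     {f. bij_betw f (carrier A) (carrier B) \<and>
         (\<forall>r \<in> symbols L. \<forall>xs \<in> lists (carrier A). length xs = arity L r \<longrightarrow>
            (xs \<in> interp A r \<longleftrightarrow> map f xs \<in> interp B r))}"

text \<open>As in \<^const>\<open>BijGroup\<close>, automorphisms are \<^const>\<open>extensional\<close> functions, so that two
  of them are equal as soon as they agree on the structure.\<close>

definition AutStruct :: "'r language \<Rightarrow> ('a, 'r) struct \<Rightarrow> ('a \<Rightarrow> 'a) monoid" where
  "AutStruct L D =
     BijGroup (carrier D) \<lparr>carrier := struct_iso L D D \<inter> extensional (carrier D)\<rparr>"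

text \<open>A partial isomorphism is represented by its graph. Its inverse is the converse relation,
  inclusion of graphs is restriction, and it is a restriction of the identity map iff
  it is contained in \<^const>\<open>Id\<close>.\<close>

definition partial_isos :: "'r language \<Rightarrow> ('a, 'r) struct \<Rightarrow> 'a rel set" where
  "partial_isos L C =
     {p. \<exists>A B f. substructure L A C \<and> finite (carrier A) \<and>
                 substructure L B C \<and> finite (carrier B) \<and>
                 f \<in> struct_iso L A B \<and> p = (\<lambda>x. (x, f x)) ` carrier A}"

definition nontriv_partial_isos :: "'r language \<Rightarrow> ('a, 'r) struct \<Rightarrow> 'a rel set" where
  "nontriv_partial_isos L C = {p \<in> partial_isos L C. \<not> p \<subseteq> Id}"

text \<open>In the following, the values of \<open>\<phi>\<close> outside \<^term>\<open>nontriv_partial_isos L C\<close> are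
  irrelevant.\<close>

definition HL_extension ::
    "'r language \<Rightarrow> ('a, 'r) struct \<Rightarrow> ('a, 'r) struct \<Rightarrow> ('a rel \<Rightarrow> 'a \<Rightarrow> 'a) \<Rightarrow> bool" where
  "HL_extension L C D \<phi> \<longleftrightarrow>
     substructure L C D \<and>
     (\<forall>p \<in> nontriv_partial_isos L C.
        \<phi> p \<in> carrier (AutStruct L D) \<and>
        (\<forall>(x, y) \<in> p. \<phi> p x = y) \<and>
        \<phi> (p\<inverse>) = inv\<^bsub>AutStruct L D\<^esub> (\<phi> p))"

definition finite_HL_extension ::
    "'r language \<Rightarrow> ('a, 'r) struct \<Rightarrow> ('a, 'r) struct \<Rightarrow> ('a rel \<Rightarrow> 'a \<Rightarrow> 'a) \<Rightarrow> bool" where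
  "finite_HL_extension L C D \<phi> \<longleftrightarrow> HL_extension L C D \<phi> \<and> finite (carrier D)"

definition minimal_HL_extension ::
    "'r language \<Rightarrow> ('a, 'r) struct \<Rightarrow> ('a, 'r) struct \<Rightarrow> ('a rel \<Rightarrow> 'a \<Rightarrow> 'a) \<Rightarrow> bool" where
  "minimal_HL_extension L C D \<phi> \<longleftrightarrow>
     HL_extension L C D \<phi> \<and>
     (\<forall>b \<in> carrier D - carrier C.
        \<exists>ps \<in> lists (nontriv_partial_isos L C). \<exists>a \<in> carrier C. b = foldr \<phi> ps a)"

definition HL_group ::
    "'r language \<Rightarrow> ('a, 'r) struct \<Rightarrow> ('a, 'r) struct \<Rightarrow> ('a rel \<Rightarrow> 'a \<Rightarrow> 'a) \<Rightarrow> ('a \<Rightarrow> 'a) monoid" where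
  "HL_group L C D \<phi> = subgroup_generated (AutStruct L D) (\<phi> ` nontriv_partial_isos L C)"

definition coherent ::
    "'r language \<Rightarrow> ('a, 'r) struct \<Rightarrow> ('a, 'r) struct \<Rightarrow> ('a rel \<Rightarrow> 'a \<Rightarrow> 'a) \<Rightarrow>
     ('a, 'r) struct \<Rightarrow> ('a, 'r) struct \<Rightarrow> ('a rel \<Rightarrow> 'a \<Rightarrow> 'a) \<Rightarrow> bool" where
  "coherent L C1 D1 \<phi>1 C2 D2 \<phi>2 \<longleftrightarrow>
     substructure L C1 C2 \<and> HL_extension L C1 D1 \<phi>1 \<and> HL_extension L C2 D2 \<phi>2 \<and>
     substructure L D1 D2 \<and>
     (\<forall>p \<in> nontriv_partial_isos L C1. \<forall>x \<in> carrier D1. \<phi>2 p x = \<phi>1 p x) \<and>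
     (\<exists>!h. h \<in> extensional (carrier (HL_group L C1 D1 \<phi>1)) \<and>
           h \<in> mon (HL_group L C1 D1 \<phi>1) (HL_group L C2 D2 \<phi>2) \<and>
           (\<forall>p \<in> nontriv_partial_isos L C1. h (\<phi>1 p) = \<phi>2 p))"

definition ultrahomogeneous :: "'r language \<Rightarrow> ('a, 'r) struct \<Rightarrow> bool" where
  "ultrahomogeneous L U \<longleftrightarrow> (\<exists>\<phi>. HL_extension L U U \<phi>)"

definition ultraextensive :: "'r language \<Rightarrow> ('a, 'r) struct \<Rightarrow> bool" where
  "ultraextensive L U \<longleftrightarrow>
     ultrahomogeneous L U \<and>
     (\<forall>C. substructure L C U \<and> finite (carrier C) \<longrightarrow>
        (\<exists>D \<phi>. substructure L D U \<and> finite_HL_extension L C D \<phi>)) \<and>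
     (\<forall>C1 C2 D1 \<phi>1.
        substructure L C1 C2 \<and> substructure L C2 U \<and>
        finite (carrier C1) \<and> finite (carrier C2) \<and> substructure L D1 U \<and>
        finite_HL_extension L C1 D1 \<phi>1 \<and> minimal_HL_extension L C1 D1 \<phi>1 \<longrightarrow>
        (\<exists>D2 \<phi>2.
           substructure L D2 U \<and>
           finite_HL_extension L C2 D2 \<phi>2 \<and> minimal_HL_extension L C2 D2 \<phi>2 \<and>
           coherent L C1 D1 \<phi>1 C2 D2 \<phi>2))"

end

theory Submission
  imports Defs
begin

text \<open>A Loewenheim-Skolem style closing-off argument: every condition in the definition of
  ultraextensiveness asks, for data supported on a finite set \<open>X\<close>, for finitely many further
  points of \<open>U\<close>. For the last condition this uses that over finite \<open>C\<^sub>1\<close> and \<open>D\<^sub>1\<close> there are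
  only finitely many choices of \<open>\<phi>\<^sub>1\<close>. Closing the carrier of \<open>C\<close> under all of these points
  in countably many steps yields the carrier of \<open>D\<close>.\<close>

section \<open>Countable closure under finitary conditions\<close>

text \<open>A countable set has only countably many finite subsets, so adjoining \<open>F X\<close>
  for all of them keeps it countable, and \<open>\<omega>\<close> many rounds suffice because a
  finite subset of the union already lies in one stage. Neither \<open>X \<subseteq> F X\<close> nor
  monotonicity of \<open>F\<close> is assumed: each stage retains the previous one.\<close>

lemma countable_closure:
  assumes F: "\<And>X. finite X \<Longrightarrow> X \<subseteq> U \<Longrightarrow> countable (F X) \<and> F X \<subseteq> U"
    and C: "countable C" "C \<subseteq> U"
  shows "\<exists>D. C \<subseteq> D \<and> D \<subseteq> U \<and> countable D \<and> (\<forall>X. finite X \<longrightarrow> X \<subseteq> D \<longrightarrow> F X \<subseteq> D)"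
proof -
  define S where "S = rec_nat C (\<lambda>_ S. S \<union> (\<Union>X\<in>{X. finite X \<and> X \<subseteq> S}. F X))"
  have S0: "S 0 = C" and
    S_Suc: "S (Suc n) = S n \<union> (\<Union>X\<in>{X. finite X \<and> X \<subseteq> S n}. F X)" for n
    by (simp_all add: S_def)
  have S: "countable (S n) \<and> S n \<subseteq> U" for n
  proof (induction n)
    case 0
    then show ?case using C by (simp add: S0)
  next
    case (Suc n)
    have "countable {X. finite X \<and> X \<subseteq> S n}"
      using Suc by (intro countable_Collect_finite_subset) simp
    then show ?case
      using Suc F unfolding S_Suc by (auto intro!: countable_UN)
  qed
  have inc: "mono S"
    unfolding mono_iff_le_Suc by (auto simp: S_Suc)
  have "F X \<subseteq> (\<Union>n. S n)" if X: "finite X" "X \<subseteq> (\<Union>n. S n)" for X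
  proof -
    \<comment> \<open>The stages form a chain, so finitely many indices can be replaced by their
      maximum.\<close>
    have "\<exists>n. X \<subseteq> S n"
      using X
    proof (induction X)
      case (insert x X)
      then obtain m n where "x \<in> S m" "X \<subseteq> S n" by auto
      moreover have "S m \<subseteq> S (max m n)" "S n \<subseteq> S (max m n)"
        by (simp_all add: monoD[OF inc])
      ultimately have "insert x X \<subseteq> S (max m n)" by blast
      then show ?case ..
    qed simp
    then obtain n where "X \<subseteq> S n" ..
    then have "F X \<subseteq> S (Suc n)" using X by (auto simp: S_Suc)
    then show ?thesis by (rule subset_trans) blast
  qed
  moreover have "C \<subseteq> (\<Union>n. S n)" using S0 UN_upper[of 0 UNIV S] by simp
  moreover have "(\<Union>n. S n) \<subseteq> U" "countable (\<Union>n. S n)" using S by (auto simp: UN_subset_iff)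
  ultimately show ?thesis by (intro exI[of _ "\<Union>n. S n"]) simp
qed

section \<open>Structures up to the interpretation of non-symbols\<close>

text \<open>Since \<open>substructure\<close> constrains \<open>interp\<close> only at symbols of
  \<open>L\<close>, a substructure of \<open>U\<close> is not determined as a record by its carrier.
  It is determined up to this relation, which the congruence lemmas show to be harmless.\<close>

definition struct_eq :: "'r language \<Rightarrow> ('a, 'r) struct \<Rightarrow> ('a, 'r) struct \<Rightarrow> bool" where
  "struct_eq L A B \<longleftrightarrow> carrier A = carrier B \<and> (\<forall>r \<in> symbols L. interp A r = interp B r)"

text \<open>The canonical representative of the substructures of \<open>U\<close> with carrier
  \<open>X\<close>. It lets arguments that count or choose range over sets of points instead of over
  structures.\<close>

definition induced :: "('a, 'r) struct \<Rightarrow> 'a set \<Rightarrow> ('a, 'r) struct" where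
  "induced U X = \<lparr>carrier = X, interp = (\<lambda>r. interp U r \<inter> lists X)\<rparr>"

lemma carrier_induced [simp]: "carrier (induced U X) = X"
  by (simp add: induced_def)

lemma substructure_induced:
  "is_struct L U \<Longrightarrow> X \<subseteq> carrier U \<Longrightarrow> substructure L (induced U X) U"
  by (fastforce simp: substructure_def is_struct_def induced_def)

lemma substructure_trans:
  assumes "substructure L A B" "substructure L B C" shows "substructure L A C"
proof -
  have "lists (carrier A) \<subseteq> lists (carrier B)"
    using assms by (intro lists_mono) (simp add: substructure_def)
  then show ?thesis using assms unfolding substructure_def by blast
qed

lemma substructure_subset:
  assumes "substructure L A U" "substructure L B U" "carrier A \<subseteq> carrier B"
  shows "substructure L A B"
  using assms lists_mono[OF assms(3)] unfolding substructure_def by blast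

lemma substructure_eqI:
  "substructure L A U \<Longrightarrow> substructure L B U \<Longrightarrow> carrier A = carrier B \<Longrightarrow> struct_eq L A B"
  by (simp add: substructure_def struct_eq_def)

lemma substructure_cong:
  "struct_eq L A A' \<Longrightarrow> struct_eq L B B' \<Longrightarrow> substructure L A B = substructure L A' B'"
  by (simp add: substructure_def struct_eq_def is_struct_def)

lemma struct_eq_refl: "struct_eq L A A"
  by (simp add: struct_eq_def)

lemma AutStruct_cong: "struct_eq L A A' \<Longrightarrow> AutStruct L A = AutStruct L A'"
  by (simp add: struct_eq_def AutStruct_def struct_iso_def)

lemma nontriv_partial_isos_cong:
  "struct_eq L A A' \<Longrightarrow> nontriv_partial_isos L A = nontriv_partial_isos L A'"
  by (simp add: nontriv_partial_isos_def partial_isos_def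
      substructure_cong[OF struct_eq_refl])

section \<open>Inverses, monotonicity and finiteness of partial isomorphisms\<close>

lemma struct_iso_inv_into:
  assumes f: "f \<in> struct_iso L A B"
  shows "inv_into (carrier A) f \<in> struct_iso L B A"
proof -
  have bij: "bij_betw f (carrier A) (carrier B)" using f by (simp add: struct_iso_def)
  let ?g = "inv_into (carrier A) f"
  have g: "bij_betw ?g (carrier B) (carrier A)" using bij by (rule bij_betw_inv_into)
  have "(xs \<in> interp B r) = (map ?g xs \<in> interp A r)"
    if "r \<in> symbols L" "xs \<in> lists (carrier B)" "length xs = arity L r" for r xs
  proof -
    have "map ?g xs \<in> lists (carrier A)" using bij_betwE[OF g] that(2) by auto
    moreover have "map f (map ?g xs) = xs"
      using that(2) bij by (auto simp: bij_betw_def f_inv_into_f intro!: map_idI)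
    ultimately show ?thesis using f that by (auto simp: struct_iso_def)
  qed
  with g show ?thesis by (simp add: struct_iso_def)
qed

lemma partial_isos_converse:
  assumes "p \<in> partial_isos L C" shows "p\<inverse> \<in> partial_isos L C"
proof -
  obtain A B f where *: "substructure L A C" "finite (carrier A)" "substructure L B C"
      "finite (carrier B)" "f \<in> struct_iso L A B" "p = (\<lambda>x. (x, f x)) ` carrier A"
    using assms by (auto simp: partial_isos_def)
  have "bij_betw f (carrier A) (carrier B)" using *(5) by (simp add: struct_iso_def)
  then have "p\<inverse> = (\<lambda>y. (y, inv_into (carrier A) f y)) ` carrier B"
    unfolding *(6) by (force simp: bij_betw_def)
  with * struct_iso_inv_into[OF *(5)] show ?thesis unfolding partial_isos_def by blast
qed

lemma nontriv_partial_isos_converse: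
  "p \<in> nontriv_partial_isos L C \<Longrightarrow> p\<inverse> \<in> nontriv_partial_isos L C"
  using partial_isos_converse by (fastforce simp: nontriv_partial_isos_def)

lemma nontriv_partial_isos_mono:
  "substructure L C D \<Longrightarrow> nontriv_partial_isos L C \<subseteq> nontriv_partial_isos L D"
  unfolding nontriv_partial_isos_def partial_isos_def by (blast intro: substructure_trans)

lemma nontriv_partial_isosD:
  assumes "p \<in> nontriv_partial_isos L C"
  shows "finite p" "p \<subseteq> carrier C \<times> carrier C"
  using assms by (auto simp: nontriv_partial_isos_def partial_isos_def substructure_def
      struct_iso_def bij_betw_def)

text \<open>As graphs, partial isomorphisms are subsets of a finite product. This bounds the domain
  of the maps \<open>\<phi>1\<close> counted later.\<close>

lemma finite_nontriv_partial_isos: "finite (carrier C) \<Longrightarrow> finite (nontriv_partial_isos L C)"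
  by (rule finite_subset[of _ "Pow (carrier C \<times> carrier C)"])
    (use nontriv_partial_isosD(2) in blast, simp)

section \<open>Automorphism groups\<close>

lemma carrier_AutStruct:
  "carrier (AutStruct L D) = struct_iso L D D \<inter> extensional (carrier D)"
  by (simp add: AutStruct_def)

text \<open>Used to pass between a map and its restriction to the carrier, since members of
  \<open>AutStruct\<close> have to be extensional.\<close>

lemma struct_iso_cong:
  assumes "\<And>x. x \<in> carrier A \<Longrightarrow> f x = g x"
  shows "f \<in> struct_iso L A B \<longleftrightarrow> g \<in> struct_iso L A B"
proof -
  have "map f xs = map g xs" if "xs \<in> lists (carrier A)" for xs
    using that assms by (intro map_cong) auto
  moreover have "bij_betw f (carrier A) (carrier B) = bij_betw g (carrier A) (carrier B)"
    using assms by (rule bij_betw_cong)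
  ultimately show ?thesis unfolding struct_iso_def by (simp cong: ball_cong del: map_eq_conv)
qed

lemma struct_iso_comp:
  assumes "f \<in> struct_iso L A B" "g \<in> struct_iso L B C"
  shows "g \<circ> f \<in> struct_iso L A C"
proof -
  have bij: "bij_betw f (carrier A) (carrier B)" using assms by (simp add: struct_iso_def)
  have "map f xs \<in> lists (carrier B)" if "xs \<in> lists (carrier A)" for xs
    using that bij_betwE[OF bij] by auto
  then show ?thesis
    using assms bij_betw_trans[OF bij, of g] by (fastforce simp: struct_iso_def)
qed

lemma AutStruct_mult:
  assumes "f \<in> carrier (AutStruct L D)" "g \<in> carrier (AutStruct L D)"
  shows "f \<otimes>\<^bsub>AutStruct L D\<^esub> g = compose (carrier D) f g"
  using assms by (auto simp: AutStruct_def BijGroup_def Bij_def struct_iso_def)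

lemma AutStruct_one: "\<one>\<^bsub>AutStruct L D\<^esub> = (\<lambda>x\<in>carrier D. x)"
  by (simp add: AutStruct_def BijGroup_def)

lemma group_AutStruct: "group (AutStruct L D)"
proof -
  have "subgroup (struct_iso L D D \<inter> extensional (carrier D)) (BijGroup (carrier D))"
  proof (rule group.subgroupI[OF group_BijGroup])
    show "struct_iso L D D \<inter> extensional (carrier D) \<subseteq> carrier (BijGroup (carrier D))"
      by (auto simp: BijGroup_def Bij_def struct_iso_def)
    \<comment> \<open>The unit of \<open>BijGroup\<close> is the restricted identity; preservation
      of the relations is immediate for \<open>id\<close> and carries over by
      \<open>struct_iso_cong\<close>.\<close>
    have "id \<in> struct_iso L D D" by (simp add: struct_iso_def)
    then have "(\<lambda>x\<in>carrier D. x) \<in> struct_iso L D D \<inter> extensional (carrier D)"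
      using struct_iso_cong[of D id "\<lambda>x\<in>carrier D. x"] by simp
    then show "struct_iso L D D \<inter> extensional (carrier D) \<noteq> {}" by blast
  next
    fix f assume f: "f \<in> struct_iso L D D \<inter> extensional (carrier D)"
    then have "f \<in> Bij (carrier D)" by (auto simp: Bij_def struct_iso_def)
    then show "inv\<^bsub>BijGroup (carrier D)\<^esub> f \<in> struct_iso L D D \<inter> extensional (carrier D)"
      using f struct_iso_inv_into[of f L D D]
        struct_iso_cong[of D "inv_into (carrier D) f" "\<lambda>x\<in>carrier D. inv_into (carrier D) f x"]
      by (simp add: inv_BijGroup)
  next
    fix f g assume fg: "f \<in> struct_iso L D D \<inter> extensional (carrier D)"
      "g \<in> struct_iso L D D \<inter> extensional (carrier D)"
    then have "f \<in> Bij (carrier D)" "g \<in> Bij (carrier D)" by (auto simp: Bij_def struct_iso_def)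
    then show "f \<otimes>\<^bsub>BijGroup (carrier D)\<^esub> g \<in> struct_iso L D D \<inter> extensional (carrier D)"
      using fg struct_iso_comp[of g L D D f D]
        struct_iso_cong[of D "f \<circ> g" "compose (carrier D) f g"]
      by (simp add: BijGroup_def compose_def)
  qed
  then show ?thesis
    unfolding AutStruct_def by (rule subgroup.subgroup_is_group[OF _ group_BijGroup])
qed

section \<open>HL-extensions\<close>

text \<open>Agreement of \<open>\<phi>\<close> and \<open>\<phi>'\<close> on the nontrivial partial
  isomorphisms is enough even for the clause on inverses, because that set is closed under
  converse.\<close>

lemma HL_extension_cong:
  assumes "struct_eq L C C'" "struct_eq L D D'"
    and "\<And>p. p \<in> nontriv_partial_isos L C \<Longrightarrow> \<phi> p = \<phi>' p"
  shows "HL_extension L C D \<phi> = HL_extension L C' D' \<phi>'"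
  using assms(3) nontriv_partial_isos_converse[of _ L C]
  unfolding HL_extension_def substructure_cong[OF assms(1,2)] AutStruct_cong[OF assms(2)]
    nontriv_partial_isos_cong[OF assms(1), symmetric]
  by auto

lemma minimal_HL_extension_cong:
  assumes "struct_eq L C C'" "struct_eq L D D'"
    and \<phi>: "\<And>p. p \<in> nontriv_partial_isos L C \<Longrightarrow> \<phi> p = \<phi>' p"
  shows "minimal_HL_extension L C D \<phi> = minimal_HL_extension L C' D' \<phi>'"
proof -
  have carrier: "carrier C' = carrier C" "carrier D' = carrier D"
    using assms(1,2) by (auto simp: struct_eq_def)
  have "foldr \<phi> ps a = foldr \<phi>' ps a" if "ps \<in> lists (nontriv_partial_isos L C)" for ps a
    using that \<phi> by (intro foldr_cong) auto
  moreover have "HL_extension L C D \<phi> = HL_extension L C' D' \<phi>'"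
    using assms by (rule HL_extension_cong)
  ultimately show ?thesis
    unfolding minimal_HL_extension_def carrier nontriv_partial_isos_cong[OF assms(1), symmetric]
    by simp
qed

lemma HL_group_cong:
  assumes "struct_eq L C C'" "struct_eq L D D'"
    and "\<And>p. p \<in> nontriv_partial_isos L C \<Longrightarrow> \<phi> p = \<phi>' p"
  shows "HL_group L C D \<phi> = HL_group L C' D' \<phi>'"
proof -
  have "\<phi> ` nontriv_partial_isos L C = \<phi>' ` nontriv_partial_isos L C"
    using assms(3) by (rule image_cong[OF refl])
  then show ?thesis
    using AutStruct_cong[OF assms(2)] nontriv_partial_isos_cong[OF assms(1)]
    by (simp add: HL_group_def)
qed

text \<open>Both sides speak of literally the same groups, generated by the same maps, so the clause
  on the unique embedding \<open>h\<close> carries over unchanged.\<close>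

lemma coherent_cong:
  assumes "struct_eq L C1 C1'" "struct_eq L C2 C2'" "struct_eq L D1 D1'"
    and \<phi>: "\<And>p. p \<in> nontriv_partial_isos L C1 \<Longrightarrow> \<phi>1 p = \<phi>1' p"
  shows "coherent L C1 D1 \<phi>1 C2 D2 \<phi>2 = coherent L C1' D1' \<phi>1' C2' D2 \<phi>2"
proof -
  have carrier: "carrier D1' = carrier D1" using assms(3) by (simp add: struct_eq_def)
  have HL: "HL_extension L C1 D1 \<phi>1 = HL_extension L C1' D1' \<phi>1'"
    and group: "HL_group L C1 D1 \<phi>1 = HL_group L C1' D1' \<phi>1'"
    using HL_extension_cong[of L C1 C1' D1 D1' \<phi>1 \<phi>1'] HL_group_cong[of L C1 C1' D1 D1' \<phi>1 \<phi>1']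
      assms(1,3) \<phi> by blast+
  show ?thesis
    unfolding coherent_def carrier substructure_cong[OF assms(1,2)] HL group
      substructure_cong[OF assms(3) struct_eq_refl]
      HL_extension_cong[OF assms(2) struct_eq_refl refl]
      HL_group_cong[OF assms(2) struct_eq_refl refl]
      nontriv_partial_isos_cong[OF assms(1), symmetric]
    using \<phi> by simp
qed

section \<open>Ultrahomogeneity of closed substructures\<close>

lemma ultrahomogeneous_closed_substructure:
  assumes \<phi>: "HL_extension L U U \<phi>" and D: "substructure L D U"
    and closed: "\<And>p. p \<in> nontriv_partial_isos L D \<Longrightarrow> \<phi> p ` carrier D \<subseteq> carrier D"
  shows "ultrahomogeneous L D"
proof -
  let ?P = "nontriv_partial_isos L D"
  define \<psi> where "\<psi> p = restrict (\<phi> p) (carrier D)" for p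
  have DU: "carrier D \<subseteq> carrier U" using D by (simp add: substructure_def)
  have PU: "?P \<subseteq> nontriv_partial_isos L U" using D by (rule nontriv_partial_isos_mono)
  have Aut: "\<phi> p \<in> carrier (AutStruct L U)" if "p \<in> ?P" for p
    using that PU \<phi> by (auto simp: HL_extension_def)
  \<comment> \<open>The inverse law in the automorphism group of \<open>U\<close>, evaluated at a
    point of \<open>D\<close>. Applied to the converse of \<open>p\<close> as well, it gives a
    two-sided inverse on \<open>D\<close>.\<close>
  have inverse: "\<phi> (p\<inverse>) (\<phi> p x) = x" if p: "p \<in> ?P" and x: "x \<in> carrier D" for p x
  proof -
    have "\<phi> (p\<inverse>) = inv\<^bsub>AutStruct L U\<^esub> \<phi> p" using p PU \<phi> by (auto simp: HL_extension_def)
    then have "\<phi> (p\<inverse>) \<otimes>\<^bsub>AutStruct L U\<^esub> \<phi> p = \<one>\<^bsub>AutStruct L U\<^esub>"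
      using group.l_inv[OF group_AutStruct] Aut[OF p] by metis
    then have "compose (carrier U) (\<phi> (p\<inverse>)) (\<phi> p) = (\<lambda>x\<in>carrier U. x)"
      using AutStruct_mult[OF Aut Aut] p nontriv_partial_isos_converse AutStruct_one by metis
    from fun_cong[OF this, of x] x DU show ?thesis by (auto simp: compose_def)
  qed
  have \<psi>_Aut: "\<psi> p \<in> carrier (AutStruct L D)" if p: "p \<in> ?P" for p
  proof -
    have p': "p\<inverse> \<in> ?P" using p by (rule nontriv_partial_isos_converse)
    have "bij_betw (\<phi> p) (carrier D) (carrier D)"
      using closed[OF p] closed[OF p'] inverse[OF p] inverse[OF p']
      by (intro bij_betw_byWitness[where f' = "\<phi> (p\<inverse>)"]) auto
    moreover have "(xs \<in> interp D r) = (map (\<phi> p) xs \<in> interp D r)"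
      if r: "r \<in> symbols L" and xs: "xs \<in> lists (carrier D)" "length xs = arity L r" for r xs
    proof -
      \<comment> \<open>Both \<open>xs\<close> and its image are tuples over \<open>D\<close>, where
        the relations of \<open>D\<close> and \<open>U\<close> coincide, so the equivalence is
        inherited from \<open>U\<close>.\<close>
      have "map (\<phi> p) xs \<in> lists (carrier D)" using closed[OF p] xs(1) by (auto simp: image_subset_iff)
      moreover have "interp D r = interp U r \<inter> lists (carrier D)"
        using D r by (simp add: substructure_def)
      moreover have "xs \<in> lists (carrier U)" using xs DU by auto
      ultimately show ?thesis
        using Aut[OF p] r xs unfolding carrier_AutStruct struct_iso_def by blast
    qed
    ultimately have "\<phi> p \<in> struct_iso L D D" by (simp add: struct_iso_def)
    then show ?thesis
      using struct_iso_cong[of D "\<phi> p" "\<psi> p" L D] by (simp add: carrier_AutStruct \<psi>_def)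
  qed
  have "\<psi> (p\<inverse>) = inv\<^bsub>AutStruct L D\<^esub> \<psi> p" if p: "p \<in> ?P" for p
  proof -
    have p': "p\<inverse> \<in> ?P" using p by (rule nontriv_partial_isos_converse)
    have "compose (carrier D) (\<psi> (p\<inverse>)) (\<psi> p) = (\<lambda>x\<in>carrier D. x)"
      using closed[OF p] inverse[OF p] by (auto simp: compose_def \<psi>_def fun_eq_iff)
    then have "\<psi> (p\<inverse>) \<otimes>\<^bsub>AutStruct L D\<^esub> \<psi> p = \<one>\<^bsub>AutStruct L D\<^esub>"
      using AutStruct_mult[OF \<psi>_Aut[OF p'] \<psi>_Aut[OF p]] AutStruct_one by metis
    then show ?thesis
      using group.inv_equality[OF group_AutStruct] \<psi>_Aut[OF p] \<psi>_Aut[OF p'] by metis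
  qed
  moreover have "\<psi> p x = y" if "p \<in> ?P" "(x, y) \<in> p" for p x y
  proof -
    have "x \<in> carrier D" using nontriv_partial_isosD(2) that by blast
    then show ?thesis using that PU \<phi> by (auto simp: HL_extension_def \<psi>_def)
  qed
  moreover have "substructure L D D" using D by (auto intro: substructure_subset)
  ultimately have "HL_extension L D D \<psi>"
    using \<psi>_Aut unfolding HL_extension_def by blast
  then show ?thesis unfolding ultrahomogeneous_def by blast
qed

section \<open>Finite witness sets for finitely supported demands\<close>

text \<open>Up to \<open>struct_eq\<close> and irrelevant values of \<open>\<phi>1\<close>, a finite
  \<open>X\<close> supports only finitely many instances of each clause. One finite witness per
  instance is chosen, and \<open>Y\<close> is the union of three finite sets, one for each
  clause.\<close>

lemma ultraextensive_finite_support: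
  fixes L :: "'r language" and U :: "('a, 'r) struct"
  assumes U: "ultraextensive L U" "is_struct L U" and \<phi>: "HL_extension L U U \<phi>"
    and X: "finite X" "X \<subseteq> carrier U"
  obtains Y where "finite Y" "Y \<subseteq> carrier U"
    and "\<And>p. p \<in> nontriv_partial_isos L U \<Longrightarrow> p \<subseteq> X \<times> X \<Longrightarrow> \<phi> p ` X \<subseteq> Y"
    and "\<And>C. substructure L C U \<Longrightarrow> carrier C \<subseteq> X \<Longrightarrow>
           \<exists>D \<psi>. carrier D \<subseteq> Y \<and> substructure L D U \<and> finite_HL_extension L C D \<psi>"
    and "\<And>C1 C2 D1 \<phi>1. substructure L C1 C2 \<Longrightarrow> substructure L C2 U \<Longrightarrow> carrier C2 \<subseteq> X \<Longrightarrow>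
           substructure L D1 U \<Longrightarrow> carrier D1 \<subseteq> X \<Longrightarrow> minimal_HL_extension L C1 D1 \<phi>1 \<Longrightarrow>
           \<exists>D2 \<phi>2. carrier D2 \<subseteq> Y \<and> substructure L D2 U \<and> finite_HL_extension L C2 D2 \<phi>2 \<and>
             minimal_HL_extension L C2 D2 \<phi>2 \<and> coherent L C1 D1 \<phi>1 C2 D2 \<phi>2"
proof -
  define P where "P = {p \<in> nontriv_partial_isos L U. p \<subseteq> X \<times> X}"
  define Y1 where "Y1 = (\<Union>p\<in>P. \<phi> p ` X)"
  have "finite P"
    by (rule finite_subset[of _ "Pow (X \<times> X)"]) (auto simp: P_def X(1))
  then have Y1: "finite Y1" using X(1) by (simp add: Y1_def)
  \<comment> \<open>Automorphisms permute \<open>U\<close>, so the points collected in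
    \<open>Y1\<close> do not leave it.\<close>
  have "\<phi> p ` carrier U = carrier U" if "p \<in> P" for p
    using that \<phi> by (auto simp: P_def HL_extension_def carrier_AutStruct struct_iso_def bij_betw_def)
  then have Y1U: "Y1 \<subseteq> carrier U" using X(2) unfolding Y1_def by blast

  \<comment> \<open>Only the carrier of the extension is chosen; the structure and its
    \<open>\<psi>\<close> stay under the existential quantifier.\<close>
  have "\<forall>F\<in>Pow X. \<exists>E. finite E \<and> E \<subseteq> carrier U \<and>
      (\<exists>D \<psi>. carrier D = E \<and> substructure L D U \<and> finite_HL_extension L (induced U F) D \<psi>)"
  proof
    fix F assume "F \<in> Pow X"
    then have "substructure L (induced U F) U" "finite F"
      using U(2) X by (auto intro: substructure_induced finite_subset)
    then obtain D \<psi> where "substructure L D U" "finite_HL_extension L (induced U F) D \<psi>"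
      using U(1) unfolding ultraextensive_def by (metis carrier_induced)
    then show "\<exists>E. finite E \<and> E \<subseteq> carrier U \<and>
        (\<exists>D \<psi>. carrier D = E \<and> substructure L D U \<and> finite_HL_extension L (induced U F) D \<psi>)"
      by (auto simp: finite_HL_extension_def substructure_def)
  qed
  from bchoice[OF this] obtain E where
    "\<forall>F\<in>Pow X. finite (E F) \<and> E F \<subseteq> carrier U \<and> (\<exists>D \<psi>. carrier D = E F \<and>
      substructure L D U \<and> finite_HL_extension L (induced U F) D \<psi>)" ..
  note E = this[rule_format, OF PowI]
  define Y2 where "Y2 = (\<Union>F\<in>Pow X. E F)"
  have Y2: "finite Y2" "Y2 \<subseteq> carrier U" using E X(1) by (auto simp: Y2_def)

  \<comment> \<open>An instance of the coherence clause is coded by three carriers and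
    \<open>\<phi>1\<close>; \<open>good\<close> says that \<open>D2\<close> and
    \<open>\<phi>2\<close> answer it.\<close>
  define good where "good = (\<lambda>(F1, F2, G, \<phi>1) D2 \<phi>2. substructure L D2 U \<and>
      finite_HL_extension L (induced U F2) D2 \<phi>2 \<and>
      minimal_HL_extension L (induced U F2) D2 \<phi>2 \<and>
      coherent L (induced U F1) (induced U G) \<phi>1 (induced U F2) D2 \<phi>2)"
  \<comment> \<open>The extensional function spaces make \<open>T\<close> finite:
    \<open>\<phi>1\<close> is \<open>undefined\<close> off the partial isomorphisms, and each of its
    values is \<open>undefined\<close> off \<open>G\<close>.\<close>
  define T where "T = (SIGMA F1:Pow X. SIGMA F2:Pow X. SIGMA G:Pow X.
      nontriv_partial_isos L (induced U F1) \<rightarrow>\<^sub>E (G \<rightarrow>\<^sub>E G))"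
  have finT: "finite T"
    unfolding T_def using X(1)
    by (intro finite_SigmaI finite_PiE finite_nontriv_partial_isos)
      (auto intro: finite_subset)
  \<comment> \<open>A tuple in \<open>T\<close> need not describe a minimal HL-extension, so the
    demand is conditional. If it has no answer, any finite subset of \<open>U\<close> will
    do.\<close>
  have "\<forall>t\<in>T. \<exists>E. finite E \<and> E \<subseteq> carrier U \<and>
      ((\<exists>D2 \<phi>2. good t D2 \<phi>2) \<longrightarrow> (\<exists>D2 \<phi>2. carrier D2 = E \<and> good t D2 \<phi>2))"
  proof
    fix t
    show "\<exists>E. finite E \<and> E \<subseteq> carrier U \<and>
      ((\<exists>D2 \<phi>2. good t D2 \<phi>2) \<longrightarrow> (\<exists>D2 \<phi>2. carrier D2 = E \<and> good t D2 \<phi>2))"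
    proof (cases "\<exists>D2 \<phi>2. good t D2 \<phi>2")
      case True
      then obtain D2 \<phi>2 where "good t D2 \<phi>2" by blast
      moreover from this have "finite (carrier D2)" "carrier D2 \<subseteq> carrier U"
        by (auto simp: good_def finite_HL_extension_def substructure_def split: prod.splits)
      ultimately show ?thesis by blast
    qed blast
  qed
  from bchoice[OF this] obtain H where
    H: "\<forall>t\<in>T. finite (H t) \<and> H t \<subseteq> carrier U \<and>
      ((\<exists>D2 \<phi>2. good t D2 \<phi>2) \<longrightarrow> (\<exists>D2 \<phi>2. carrier D2 = H t \<and> good t D2 \<phi>2))" ..
  define Y3 where "Y3 = (\<Union>t\<in>T. H t)"
  have Y3: "finite Y3" "Y3 \<subseteq> carrier U" using H finT by (auto simp: Y3_def)

  show thesis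
  proof (rule that[of "Y1 \<union> Y2 \<union> Y3"])
    show "finite (Y1 \<union> Y2 \<union> Y3)" using Y1 Y2(1) Y3(1) by simp
    show "Y1 \<union> Y2 \<union> Y3 \<subseteq> carrier U" using Y1U Y2(2) Y3(2) by blast
  next
    fix p assume "p \<in> nontriv_partial_isos L U" "p \<subseteq> X \<times> X"
    then show "\<phi> p ` X \<subseteq> Y1 \<union> Y2 \<union> Y3" by (auto simp: Y1_def P_def)
  next
    fix C assume C: "substructure L C U" "carrier C \<subseteq> X"
    \<comment> \<open>The witness was chosen for the induced structure; \<open>C\<close> may differ
      from it at non-symbols, hence the transfer along \<open>eq\<close>.\<close>
    let ?C = "induced U (carrier C)"
    have eq: "struct_eq L C ?C"
      using C U(2) X(2) by (intro substructure_eqI[of L C U] substructure_induced) auto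
    obtain D \<psi> where "carrier D = E (carrier C)" "substructure L D U" "finite_HL_extension L ?C D \<psi>"
      using E[OF C(2)] by blast
    moreover have "E (carrier C) \<subseteq> Y2" using C by (auto simp: Y2_def)
    ultimately show "\<exists>D \<psi>. carrier D \<subseteq> Y1 \<union> Y2 \<union> Y3 \<and> substructure L D U \<and>
        finite_HL_extension L C D \<psi>"
      using HL_extension_cong[OF eq struct_eq_refl refl] unfolding finite_HL_extension_def by blast
  next
    fix C1 C2 D1 :: "('a, 'r) struct" and \<phi>1
    assume C1: "substructure L C1 C2" and C2: "substructure L C2 U" "carrier C2 \<subseteq> X"
      and D1: "substructure L D1 U" "carrier D1 \<subseteq> X" and min: "minimal_HL_extension L C1 D1 \<phi>1"
    let ?C1 = "induced U (carrier C1)" and ?C2 = "induced U (carrier C2)"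
      and ?D1 = "induced U (carrier D1)"
    have C1U: "substructure L C1 U" using C1 C2(1) by (rule substructure_trans)
    have C1X: "carrier C1 \<subseteq> X" using C1 C2 by (auto simp: substructure_def)
    have ind: "substructure L ?C1 U" "substructure L ?C2 U" "substructure L ?D1 U"
      using C1X C2 D1 U(2) X(2) by (auto intro!: substructure_induced)
    have eq: "struct_eq L C1 ?C1" "struct_eq L C2 ?C2" "struct_eq L D1 ?D1"
      using C1U C2 D1 ind by (auto intro: substructure_eqI)
    \<comment> \<open>Erasing the values outside the partial isomorphisms places the tuple in
      \<open>T\<close>; the congruence lemmas do not see the difference.\<close>
    define \<phi>1' where "\<phi>1' = restrict \<phi>1 (nontriv_partial_isos L C1)"
    have agree: "\<phi>1 p = \<phi>1' p" if "p \<in> nontriv_partial_isos L C1" for p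
      using that by (simp add: \<phi>1'_def)
    let ?t = "(carrier C1, carrier C2, carrier D1, \<phi>1')"
    have "\<phi>1 p \<in> carrier D1 \<rightarrow>\<^sub>E carrier D1" if "p \<in> nontriv_partial_isos L C1" for p
    proof -
      have "\<phi>1 p \<in> carrier (AutStruct L D1)"
        using that min by (simp add: minimal_HL_extension_def HL_extension_def)
      then show ?thesis
        by (auto simp: carrier_AutStruct struct_iso_def PiE_def dest: bij_betwE)
    qed
    then have t: "?t \<in> T"
      using C1X C2(2) D1(2) nontriv_partial_isos_cong[OF eq(1)] by (auto simp: T_def \<phi>1'_def)
    have min': "minimal_HL_extension L ?C1 ?D1 \<phi>1'"
      using min minimal_HL_extension_cong[of L C1 ?C1 D1 ?D1 \<phi>1 \<phi>1', OF eq(1,3)] agree by blast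
    have fin: "finite (carrier ?C1)" "finite (carrier ?C2)" "finite (carrier ?D1)"
      using C1X C2(2) D1(2) X(1) by (auto intro: finite_subset)
    have "substructure L ?C1 ?C2"
      using C1 substructure_cong[OF eq(1,2)] by simp
    moreover have "finite_HL_extension L ?C1 ?D1 \<phi>1'"
      using min' fin(3) by (simp add: minimal_HL_extension_def finite_HL_extension_def)
    \<comment> \<open>For an actual minimal HL-extension the condition attached to
      \<open>H ?t\<close> is met, by the coherence clause of ultraextensiveness of
      \<open>U\<close>.\<close>
    ultimately have "\<exists>D2 \<phi>2. good ?t D2 \<phi>2"
      using U(1) ind fin min' unfolding ultraextensive_def good_def by simp
    then obtain D2 \<phi>2 where "carrier D2 = H ?t" and good: "good ?t D2 \<phi>2"
      using bspec[OF H t] by blast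
    then have "carrier D2 \<subseteq> Y1 \<union> Y2 \<union> Y3" using t by (auto simp: Y3_def)
    moreover have coh: "coherent L C1 D1 \<phi>1 C2 D2 \<phi>2 =
        coherent L ?C1 ?D1 \<phi>1' ?C2 D2 \<phi>2"
      using eq agree by (rule coherent_cong)
    ultimately show "\<exists>D2 \<phi>2. carrier D2 \<subseteq> Y1 \<union> Y2 \<union> Y3 \<and> substructure L D2 U \<and>
        finite_HL_extension L C2 D2 \<phi>2 \<and> minimal_HL_extension L C2 D2 \<phi>2 \<and>
        coherent L C1 D1 \<phi>1 C2 D2 \<phi>2"
      using good HL_extension_cong[OF eq(2) struct_eq_refl refl]
        minimal_HL_extension_cong[OF eq(2) struct_eq_refl refl] coh
      unfolding good_def finite_HL_extension_def by (intro exI[of _ D2] exI[of _ \<phi>2]) simp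
  qed
qed

section \<open>Closing off the given countable substructure\<close>

theorem theorem1p5:
  fixes L :: "'r language" and U C :: "('a, 'r) struct"
  assumes "finite (symbols L)"
    and "ultraextensive L U"
    and "substructure L C U"
    and "countable (carrier C)"
  shows "\<exists>D. substructure L C D \<and> substructure L D U \<and> countable (carrier D) \<and> ultraextensive L D"
proof -
  have U: "is_struct L U" and CU: "carrier C \<subseteq> carrier U"
    using assms(3) by (auto simp: substructure_def)
  \<comment> \<open>One choice of automorphisms is fixed before closing off, so that the closed set
    is invariant under this very family.\<close>
  obtain \<phi> where \<phi>: "HL_extension L U U \<phi>"
    using assms(2) by (auto simp: ultraextensive_def ultrahomogeneous_def)
  \<comment> \<open>\<open>Q X Y\<close> says that \<open>Y\<close> contains answers to all demands
    supported on \<open>X\<close>; packing them into one predicate allows a single choice function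
    \<open>F\<close>.\<close>
  define Q where "Q X Y \<longleftrightarrow>
      (\<forall>p \<in> nontriv_partial_isos L U. p \<subseteq> X \<times> X \<longrightarrow> \<phi> p ` X \<subseteq> Y) \<and>
      (\<forall>C. substructure L C U \<and> carrier C \<subseteq> X \<longrightarrow>
        (\<exists>D \<psi>. carrier D \<subseteq> Y \<and> substructure L D U \<and> finite_HL_extension L C D \<psi>)) \<and>
      (\<forall>C1 C2 D1 \<phi>1. substructure L C1 C2 \<and> substructure L C2 U \<and> carrier C2 \<subseteq> X \<and>
        substructure L D1 U \<and> carrier D1 \<subseteq> X \<and> minimal_HL_extension L C1 D1 \<phi>1 \<longrightarrow>
        (\<exists>D2 \<phi>2. carrier D2 \<subseteq> Y \<and> substructure L D2 U \<and> finite_HL_extension L C2 D2 \<phi>2 \<and>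
          minimal_HL_extension L C2 D2 \<phi>2 \<and> coherent L C1 D1 \<phi>1 C2 D2 \<phi>2))" for X Y
  have "\<forall>X\<in>{X. finite X \<and> X \<subseteq> carrier U}. \<exists>Y. countable Y \<and> Y \<subseteq> carrier U \<and> Q X Y"
  proof
    fix X assume "X \<in> {X. finite X \<and> X \<subseteq> carrier U}"
    then have X: "finite X" "X \<subseteq> carrier U" by auto
    obtain Y where "finite Y" "Y \<subseteq> carrier U" "Q X Y"
      unfolding Q_def
      by (rule ultraextensive_finite_support[OF assms(2) U \<phi> X]) simp
    then show "\<exists>Y. countable Y \<and> Y \<subseteq> carrier U \<and> Q X Y"
      using countable_finite by blast
  qed
  from bchoice[OF this] obtain F where
    "\<forall>X\<in>{X. finite X \<and> X \<subseteq> carrier U}. countable (F X) \<and> F X \<subseteq> carrier U \<and> Q X (F X)" ..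
  then have F: "countable (F X) \<and> F X \<subseteq> carrier U \<and> Q X (F X)"
    if "finite X" "X \<subseteq> carrier U" for X
    using that by simp
  have "\<exists>S. carrier C \<subseteq> S \<and> S \<subseteq> carrier U \<and> countable S \<and>
      (\<forall>X. finite X \<longrightarrow> X \<subseteq> S \<longrightarrow> F X \<subseteq> S)"
    using F by (intro countable_closure assms(4) CU) simp
  then obtain S where S: "carrier C \<subseteq> S" "S \<subseteq> carrier U" "countable S"
    and FS: "\<And>X. finite X \<Longrightarrow> X \<subseteq> S \<Longrightarrow> F X \<subseteq> S"
    by (elim exE conjE) simp
  define D where "D = induced U S"
  have carrier_D: "carrier D = S" by (simp add: D_def)
  have D: "substructure L D U" unfolding D_def using U S(2) by (rule substructure_induced)
  \<comment> \<open>Witnesses are found as substructures of \<open>U\<close>; once their points lie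
    in \<open>S\<close>, they are substructures of \<open>D\<close>.\<close>
  have sub_D: "substructure L A D" if "substructure L A U" "carrier A \<subseteq> S" for A
    using that D carrier_D by (auto intro: substructure_subset)
  have Q: "Q X (F X)" if "finite X" "X \<subseteq> S" for X
    using that F S(2) by blast
  note Q1 = Q[unfolded Q_def, THEN conjunct1, rule_format]
    and Q2 = Q[unfolded Q_def, THEN conjunct2, THEN conjunct1, rule_format, OF _ _ conjI]
    and Q3 = Q[unfolded Q_def, THEN conjunct2, THEN conjunct2, rule_format]
  have "ultrahomogeneous L D"
  proof (rule ultrahomogeneous_closed_substructure[OF \<phi> D])
    fix p assume p: "p \<in> nontriv_partial_isos L D"
    have pU: "p \<in> nontriv_partial_isos L U" using p nontriv_partial_isos_mono[OF D] by blast
    show "\<phi> p ` carrier D \<subseteq> carrier D"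
    proof (rule image_subsetI)
      fix x assume x: "x \<in> carrier D"
      \<comment> \<open>\<open>D\<close> may be infinite, so invariance is checked one point at a
        time: the support consists of \<open>x\<close> and the finitely many points occurring in
        \<open>p\<close>.\<close>
      define X where "X = insert x (fst ` p \<union> snd ` p)"
      have X: "finite X" "X \<subseteq> S"
        using nontriv_partial_isosD[OF p] x carrier_D by (auto simp: X_def)
      have "p \<subseteq> X \<times> X" "x \<in> X" by (force simp: X_def)+
      then have "\<phi> p x \<in> F X" using Q1[OF X pU] by blast
      then show "\<phi> p x \<in> carrier D" using FS[OF X] carrier_D by blast
    qed
  qed
  moreover have "\<exists>E \<psi>. substructure L E D \<and> finite_HL_extension L B E \<psi>"
    if B: "substructure L B D" "finite (carrier B)" for B
  proof -
    have BS: "carrier B \<subseteq> S" using B carrier_D by (auto simp: substructure_def)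
    have BU: "substructure L B U" using B(1) D by (rule substructure_trans)
    obtain E \<psi> where "carrier E \<subseteq> F (carrier B)" "substructure L E U"
        "finite_HL_extension L B E \<psi>"
      using Q2[OF B(2) BS BU subset_refl] by blast
    then show ?thesis using sub_D FS[OF B(2) BS] by blast
  qed
  moreover have "\<exists>D2 \<phi>2. substructure L D2 D \<and> finite_HL_extension L C2 D2 \<phi>2 \<and>
      minimal_HL_extension L C2 D2 \<phi>2 \<and> coherent L C1 D1 \<phi>1 C2 D2 \<phi>2"
    if C1: "substructure L C1 C2" and C2: "substructure L C2 D" "finite (carrier C2)"
      and D1: "substructure L D1 D" "finite_HL_extension L C1 D1 \<phi>1"
        "minimal_HL_extension L C1 D1 \<phi>1" for C1 C2 D1 \<phi>1
  proof -
    \<comment> \<open>A support for the whole instance, as \<open>C1\<close> lies inside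
      \<open>C2\<close>. It is finite because \<open>D1\<close> is a finite HL-extension.\<close>
    define X where "X = carrier C2 \<union> carrier D1"
    have X: "finite X" "X \<subseteq> S"
      using C2 D1 carrier_D by (auto simp: X_def substructure_def finite_HL_extension_def)
    have "substructure L C2 U" "substructure L D1 U"
      using C2(1) D1(1) by (simp_all add: substructure_trans[OF _ D])
    moreover have "carrier C2 \<subseteq> X" "carrier D1 \<subseteq> X" by (auto simp: X_def)
    ultimately obtain D2 \<phi>2 where "carrier D2 \<subseteq> F X" "substructure L D2 U"
        "finite_HL_extension L C2 D2 \<phi>2" "minimal_HL_extension L C2 D2 \<phi>2"
        "coherent L C1 D1 \<phi>1 C2 D2 \<phi>2"
      using Q3[OF X, of C1 C2 D1 \<phi>1] C1 D1(3) by blast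
    then show ?thesis using sub_D FS[OF X] by blast
  qed
  ultimately have "ultraextensive L D"
    unfolding ultraextensive_def by simp
  moreover have "substructure L C D" using sub_D assms(3) S(1) by blast
  ultimately show ?thesis using D S(3) carrier_D by blast
qed

end
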